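(* For $n \geq 0$ let \[ H_n(p,q) := \sum_{w \in S_n} p^{\mathrm{inv}(w)} q^{\mathrm{maj}(w)}. \] There are constants $c_\mu \in \mathbb{Z}$ indexed by integer partitions $\mu$ such that \[ \frac{H_n(p,q)}{n!} = \frac{[n]_p!\,[n]_q!}{n!^2}\, F_n(p,q), \] where \[ F_n(p,q) = \sum_{d=0}^{n} \big[(1-p)(1-q)\big]^d \sum_{\substack{\mu \vdash n \\ \ell(\mu) = n-d}} \frac{c_\mu}{\prod_i [\mu_i]_p\,[\mu_i]_q}. \]
   Context: For a permutation $w = w_1\cdots w_n \in S_n$, $\mathrm{inv}(w) := \#\{i<j : w_i > w_j\}$ and $\mathrm{maj}(w) := \sum_{1 \le i \le n-1,\ w_i > w_{i+1}} i$. For a positive integer $c$, $[c]_p := 1 + p + \cdots + p^{c-1} = (1-p^c)/(1-p)$, and $[n]_p! := [n]_p [n-1]_p \cdots [1]_p$. For an integer partition $\mu = (\mu_1 \ge \mu_2 \ge \cdots)$ of $n$ (written $\mu \vdash n$), $\ell(\mu)$ denotes its number of parts. The identity is an identity of rational functions in $p, q$. *)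

theory Defs
  imports
    "HOL-Combinatorics.Permutations"
    "HOL-Computational_Algebra.Computational_Algebra"
begin

text \<open>The elements of \<open>S\<^sub>n\<close> are the functions \<open>w\<close> with \<open>w permutes {1..n}\<close>;
  the one-line notation is \<open>w 1, \<dots>, w n\<close>.\<close>

definition inv_stat :: "nat \<Rightarrow> (nat \<Rightarrow> nat) \<Rightarrow> nat" where
  "inv_stat n w = card {(i, j). 1 \<le> i \<and> i < j \<and> j \<le> n \<and> w i > w j}"

definition maj_stat :: "nat \<Rightarrow> (nat \<Rightarrow> nat) \<Rightarrow> nat" where
  "maj_stat n w = (\<Sum>i | 1 \<le> i \<and> i + 1 \<le> n \<and> w i > w (i + 1). i)"

definition H :: "nat \<Rightarrow> 'a::comm_ring_1 \<Rightarrow> 'a \<Rightarrow> 'a" where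
  "H n p q = (\<Sum>w | w permutes {1..n}. p ^ inv_stat n w * q ^ maj_stat n w)"

definition q_int :: "nat \<Rightarrow> 'a::comm_ring_1 \<Rightarrow> 'a" where
  "q_int c x = (\<Sum>i<c. x ^ i)"

definition q_fact :: "nat \<Rightarrow> 'a::comm_ring_1 \<Rightarrow> 'a" where
  "q_fact n x = (\<Prod>c=1..n. q_int c x)"

definition partitions :: "nat \<Rightarrow> nat list set" where
  "partitions n = {\<mu>. sorted_wrt (\<ge>) \<mu> \<and> (\<forall>m\<in>set \<mu>. m > 0) \<and> sum_list \<mu> = n}"

definition F :: "(nat list \<Rightarrow> int) \<Rightarrow> nat \<Rightarrow> 'a::field \<Rightarrow> 'a \<Rightarrow> 'a" where
  "F c n p q = (\<Sum>d=0..n. ((1 - p) * (1 - q)) ^ d *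
     (\<Sum>\<mu> | \<mu> \<in> partitions n \<and> length \<mu> = n - d.
        of_int (c \<mu>) / (\<Prod>i<length \<mu>. q_int (\<mu> ! i) p * q_int (\<mu> ! i) q)))"

text \<open>The field \<open>\<rat>(p, q)\<close> of rational functions, as the fraction field of \<open>\<rat>[p][q]\<close>,
  and its two indeterminates.\<close>

type_synonym ratfun2 = "rat poly poly fract"

definition indet_p :: ratfun2 where
  "indet_p = Fraction_Field.Fract [:[:0, 1:]:] 1"

definition indet_q :: ratfun2 where
  "indet_q = Fraction_Field.Fract [:0, 1:] 1"

text \<open>A sum over an infinite set is \<open>0\<close> by convention; the inner sum in \<^const>\<open>F\<close>
  is over a finite set.\<close>

lemma finite_partitions: "finite (partitions n)"
proof (rule finite_subset)
  show "partitions n \<subseteq> {\<mu>. set \<mu> \<subseteq> {..n} \<and> length \<mu> \<le> n}"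
  proof
    fix \<mu> assume "\<mu> \<in> partitions n"
    then have pos: "\<forall>m\<in>set \<mu>. m > 0" and sum: "sum_list \<mu> = n"
      by (auto simp: partitions_def)
    have "length \<mu> \<le> sum_list \<mu>"
      using pos by (induction \<mu>) auto
    moreover have "set \<mu> \<subseteq> {..n}"
      using sum member_le_sum_list by fastforce
    ultimately show "\<mu> \<in> {\<mu>. set \<mu> \<subseteq> {..n} \<and> length \<mu> \<le> n}"
      using sum by simp
  qed
qed (rule finite_lists_length_le, simp)

lemma q_int_eq_quotient: "x \<noteq> 1 \<Longrightarrow> q_int c x = (1 - x ^ c) / (1 - x)" for x :: "'a::field"
  by (simp add: q_int_def sum_gp_strict)

end

(*
  Put A(z) = exp (sum_k z^k / (k (1 - p^k) (1 - q^k))).  Then A(z) = A(q z) C(z), where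
  C(z) = exp (sum_k z^k / (k (1 - p^k))) = sum_n z^n / (p;p)_n.  Counting permutations by their
  final increasing run yields the same recurrence (Garsia-Gessel), hence
  H_n = (p;p)_n (q;q)_n [z^n] A(z).  The Newton recurrence coming from A' = A (log A)' writes
  n! [z^n] A(z) as an integral combination of the products of 1 / ((1 - p^m) (1 - q^m)) over the
  parts m of the partitions of n, and pulling out the factors 1 - p and 1 - q gives the claim.
*)
theory Submission
  imports Defs
begin

section \<open>Permutations by their last letter\<close>

definition weight :: "nat \<Rightarrow> 'a::comm_ring_1 \<Rightarrow> 'a \<Rightarrow> (nat \<Rightarrow> nat) \<Rightarrow> 'a" where
  "weight n p q w = p ^ inv_stat n w * q ^ maj_stat n w"

text \<open>The cycle that moves \<open>Suc n\<close> to \<open>j\<close> and raises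
  \<open>j, ..., n\<close> by one. Composed on the left with a permutation \<open>w\<close> of
  \<open>{1..n}\<close>, which fixes \<open>Suc n\<close>, it appends the last letter
  \<open>j\<close> and keeps the relative order of the earlier letters.\<close>

definition shift_above :: "nat \<Rightarrow> nat \<Rightarrow> nat \<Rightarrow> nat" where
  "shift_above n j i = (if i < j \<or> i > Suc n then i else if i = Suc n then j else Suc i)"

lemma shift_above_permutes:
  assumes "1 \<le> j" "j \<le> Suc n"
  shows "shift_above n j permutes {1..Suc n}"
proof (rule inj_imp_permutes)
  show "inj_on (shift_above n j) {1..Suc n}"
    using assms by (auto simp: inj_on_def shift_above_def split: if_splits)
qed (use assms in \<open>auto simp: shift_above_def\<close>)

lemma shift_above_less_iff:
  "a \<le> n \<Longrightarrow> b \<le> n \<Longrightarrow> shift_above n j a < shift_above n j b \<longleftrightarrow> a < b"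
  by (auto simp: shift_above_def)

lemma bij_betw_permutes_last:
  assumes "1 \<le> j" "j \<le> Suc n"
  shows "bij_betw ((\<circ>) (shift_above n j)) {w. w permutes {1..n}} {w. w permutes {1..Suc n} \<and> w (Suc n) = j}"
proof -
  define s where "s = shift_above n j"
  have s: "s permutes {1..Suc n}"
    unfolding s_def using assms by (rule shift_above_permutes)
  have last: "s (Suc n) = j"
    using assms by (auto simp: s_def shift_above_def)
  show ?thesis unfolding s_def[symmetric]
  proof (rule bij_betwI[where g = "(\<circ>) (inv s)"])
    show "(\<circ>) s \<in> {w. w permutes {1..n}} \<rightarrow> {w. w permutes {1..Suc n} \<and> w (Suc n) = j}"
    proof safe
      fix w assume w: "w permutes {1..n}"
      then have "w permutes {1..Suc n}" by (rule permutes_subset) auto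
      then show "s \<circ> w permutes {1..Suc n}" using s by (rule permutes_compose)
      have "w (Suc n) = Suc n" using w by (rule permutes_not_in) auto
      then show "(s \<circ> w) (Suc n) = j" using last by simp
    qed
    show "(\<circ>) (inv s) \<in> {w. w permutes {1..Suc n} \<and> w (Suc n) = j} \<rightarrow> {w. w permutes {1..n}}"
    proof safe
      fix w assume w: "w permutes {1..Suc n}" and j: "j = w (Suc n)"
      have "inv s \<circ> w permutes {1..Suc n}"
        using w permutes_inv[OF s] by (rule permutes_compose)
      moreover have "(inv s \<circ> w) x = x" if "x \<in> {1..Suc n} - {1..n}" for x
      proof -
        have "x = Suc n" using that by auto
        then show ?thesis using j last permutes_inverses(2)[OF s, of "Suc n"] by simp
      qed
      ultimately show "inv s \<circ> w permutes {1..n}"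
        by (auto intro: permutes_superset)
    qed
  qed (auto simp: fun_eq_iff permutes_inverses[OF s])
qed

text \<open>The new last letter \<open>j\<close> forms an inversion with exactly those earlier
  letters that are raised, the \<open>Suc n - j\<close> letters of \<open>w\<close> from
  \<open>j\<close> on. The only possible new descent is at position \<open>n\<close>, and it occurs
  iff \<open>j \<le> w n\<close>.\<close>

lemma weight_shift_above:
  assumes j: "1 \<le> j" "j \<le> Suc n" and w: "w permutes {1..n}"
  shows "weight (Suc n) p q (shift_above n j \<circ> w) =
    p ^ (Suc n - j) * (if w n < j then 1 else q ^ n) * weight n p q w"
proof -
  define v where "v = shift_above n j \<circ> w"
  have fin: "finite {(a, b). 1 \<le> a \<and> a < b \<and> b \<le> n \<and> w b < w a}"
    by (rule finite_subset[of _ "{..n} \<times> {..n}"]) auto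
  have le: "w i \<le> n" if "i \<le> n" for i
    using permutes_in_image[OF w, of i] permutes_not_in[OF w, of i] that
    by (cases "i = 0") auto
  have v_less: "v a < v b \<longleftrightarrow> w a < w b" if "a \<le> n" "b \<le> n" for a b
    unfolding v_def o_def using that le by (intro shift_above_less_iff) auto
  have wn: "w (Suc n) = Suc n" using w by (rule permutes_not_in) auto
  have v_last: "v (Suc n) = j"
    using j by (simp add: v_def wn shift_above_def)
  have v_gt: "j < v i \<longleftrightarrow> j \<le> w i" if "i \<le> n" for i
    using le[OF that] j by (auto simp: v_def shift_above_def)
  have "{(a, b). 1 \<le> a \<and> a < b \<and> b \<le> Suc n \<and> v a > v b} =
      {(a, b). 1 \<le> a \<and> a < b \<and> b \<le> n \<and> w a > w b} \<union> (\<lambda>a. (a, Suc n)) ` {a \<in> {1..n}. j \<le> w a}"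
    by (auto simp: v_less v_last v_gt le_Suc_eq)
  moreover have "card {a \<in> {1..n}. j \<le> w a} = Suc n - j"
  proof -
    have "w ` {a \<in> {1..n}. j \<le> w a} = {j..n}"
    proof (intro equalityI subsetI)
      fix y assume y: "y \<in> {j..n}"
      then have "y \<in> w ` {1..n}" using j permutes_image[OF w] by auto
      then show "y \<in> w ` {a \<in> {1..n}. j \<le> w a}" using y by auto
    qed (use le in auto)
    moreover have "inj_on w {a \<in> {1..n}. j \<le> w a}"
      using permutes_inj_on[OF w] by blast
    ultimately show ?thesis by (metis card_atLeastAtMost card_image)
  qed
  moreover have "card ((\<lambda>a. (a, Suc n)) ` {a \<in> {1..n}. j \<le> w a}) = card {a \<in> {1..n}. j \<le> w a}"
    by (intro card_image) (auto simp: inj_on_def)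
  moreover have "card ({(a, b). 1 \<le> a \<and> a < b \<and> b \<le> n \<and> w a > w b} \<union> (\<lambda>a. (a, Suc n)) ` {a \<in> {1..n}. j \<le> w a}) =
      card {(a, b). 1 \<le> a \<and> a < b \<and> b \<le> n \<and> w a > w b} + card ((\<lambda>a. (a, Suc n)) ` {a \<in> {1..n}. j \<le> w a})"
    by (intro card_Un_disjoint fin) auto
  ultimately have inv: "inv_stat (Suc n) v = inv_stat n w + (Suc n - j)"
    unfolding inv_stat_def by presburger
  have "{i. 1 \<le> i \<and> i + 1 \<le> Suc n \<and> v i > v (i + 1)} =
      {i. 1 \<le> i \<and> i + 1 \<le> n \<and> w i > w (i + 1)} \<union> {i. i = n \<and> 1 \<le> n \<and> \<not> w n < j}" (is "?L = ?A \<union> ?B")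
    by (auto simp: v_less v_gt v_last le_Suc_eq)
  moreover have "sum (\<lambda>i. i) (?A \<union> ?B) = sum (\<lambda>i. i) ?A + sum (\<lambda>i. i) ?B"
    by (rule sum.union_disjoint) (auto intro: finite_subset[of _ "{..n}"])
  \<comment> \<open>For \<open>n = 0\<close> the set is empty, and both branches on the right are
    \<open>0\<close>.\<close>
  moreover have "sum (\<lambda>i. i) ?B = (if w n < j then 0 else n)"
    by (cases "n = 0") auto
  ultimately have "maj_stat (Suc n) v = maj_stat n w + (if w n < j then 0 else n)"
    unfolding maj_stat_def by simp
  with inv show ?thesis
    unfolding weight_def v_def by (simp add: power_add algebra_simps)
qed

text \<open>For \<open>n = 0\<close> the last letter is \<open>w 0 = 0\<close>, so that the first letter of a word counts as an ascent.\<close>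

definition H_last :: "nat \<Rightarrow> 'a::comm_ring_1 \<Rightarrow> 'a \<Rightarrow> nat \<Rightarrow> 'a" where
  "H_last n p q j = (\<Sum>w | w permutes {1..n} \<and> w n = j. weight n p q w)"

lemma permutes_last_le: "w permutes {1..n} \<Longrightarrow> w n \<le> (n::nat)"
  using permutes_in_image[of w "{1..n}" n] permutes_not_in[of w "{1..n}" n] by (cases "n = 0") auto

lemma sum_permutes_last:
  "(\<Sum>w | w permutes {1..n} \<and> P (w n). weight n p q w) = (\<Sum>j | j \<le> n \<and> P j. H_last n p q j)"
proof -
  have fin: "finite {w. w permutes {1..n}}" by (simp add: finite_permutations)
  have "(\<Sum>j | j \<le> n \<and> P j. H_last n p q j) =
      (\<Sum>j | j \<le> n \<and> P j. sum (weight n p q) {w \<in> {w. w permutes {1..n} \<and> P (w n)}. w n = j})"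
    unfolding H_last_def by (intro sum.cong refl) auto
  also have "\<dots> = sum (weight n p q) {w. w permutes {1..n} \<and> P (w n)}"
    using fin by (intro sum.group) (auto intro: permutes_last_le)
  finally show ?thesis by simp
qed

lemma H_eq_sum_H_last: "H n p q = (\<Sum>j\<le>n. H_last n p q j)"
  using sum_permutes_last[where P = "\<lambda>_. True", of n p q] by (simp add: H_def weight_def atMost_def)

lemma H_last_0: "H_last 0 p q j = (if j = 0 then 1 else 0)"
proof -
  have "{(i, j). 1 \<le> i \<and> i < j \<and> j \<le> (0::nat) \<and> id i > id j} = {}" by auto
  then have "inv_stat 0 id = 0" unfolding inv_stat_def by (simp only: card.empty)
  moreover have "maj_stat 0 id = 0" by (simp add: maj_stat_def)
  moreover have "{w. w = id \<and> w 0 = j} = (if j = 0 then {id} else {})" by auto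
  ultimately show ?thesis by (simp add: H_last_def weight_def)
qed

lemma H_last_Suc_0: "H_last (Suc n) p q 0 = 0"
proof -
  have none: "{w. w permutes {1..Suc n} \<and> w (Suc n) = 0} = {}"
    using permutes_in_image[of _ "{1..Suc n}" "Suc n"] by fastforce
  show ?thesis unfolding H_last_def none by simp
qed

text \<open>The factor contributed by position \<open>n\<close> is split as \<open>q ^ n\<close> for
  every word plus the correction \<open>1 - q ^ n\<close> for those with \<open>w n < j\<close>. The
  first part sums to all of \<open>H n p q\<close>, the second to a partial sum.\<close>

lemma H_last_Suc:
  assumes j: "j \<le> Suc n"
  shows "H_last (Suc n) p q j = (if j = 0 then 0 else p ^ (Suc n - j) *
    (q ^ n * H n p q + (1 - q ^ n) * (\<Sum>i<j. H_last n p q i)))"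
proof (cases "j = 0")
  case False
  then have "1 \<le> j" by simp
  have fin: "finite {w. w permutes {1..n}}" by (simp add: finite_permutations)
  have lt: "(\<Sum>w | w permutes {1..n} \<and> w n < j. weight n p q w) = (\<Sum>i<j. H_last n p q i)"
    using j by (subst sum_permutes_last) (auto intro!: sum.cong)
  have "H_last (Suc n) p q j = (\<Sum>w | w permutes {1..n}. weight (Suc n) p q (shift_above n j \<circ> w))"
    unfolding H_last_def using bij_betw_permutes_last[OF \<open>1 \<le> j\<close> j] by (rule sum.reindex_bij_betw[symmetric])
  also have "\<dots> = (\<Sum>w | w permutes {1..n}. p ^ (Suc n - j) * (q ^ n * weight n p q w +
      (1 - q ^ n) * (if w n < j then weight n p q w else 0)))"
    by (intro sum.cong refl) (auto simp: weight_shift_above[OF \<open>1 \<le> j\<close> j] algebra_simps)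
  also have "\<dots> = p ^ (Suc n - j) * (q ^ n * (\<Sum>w | w permutes {1..n}. weight n p q w) +
      (1 - q ^ n) * (\<Sum>w | w permutes {1..n}. if w n < j then weight n p q w else 0))"
    by (simp only: sum.distrib flip: sum_distrib_left)
  also have "(\<Sum>w | w permutes {1..n}. if w n < j then weight n p q w else 0) = (\<Sum>i<j. H_last n p q i)"
    using fin by (subst lt[symmetric], subst sum.inter_filter[symmetric]) auto
  finally show ?thesis using False by (simp add: H_def weight_def)
qed (simp add: H_last_Suc_0)

section \<open>Final increasing runs\<close>

fun gauss_binomial :: "nat \<Rightarrow> nat \<Rightarrow> 'a::comm_ring_1 \<Rightarrow> 'a" where
  "gauss_binomial n 0 x = 1"
| "gauss_binomial 0 (Suc k) x = 0"
| "gauss_binomial (Suc n) (Suc k) x = gauss_binomial n k x + x ^ Suc k * gauss_binomial n (Suc k) x"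

definition q_poch :: "nat \<Rightarrow> 'a::comm_ring_1 \<Rightarrow> 'a" where
  "q_poch n x = (\<Prod>i=1..n. 1 - x ^ i)"

lemma q_poch_0 [simp]: "q_poch 0 x = 1"
  by (simp add: q_poch_def)

lemma q_poch_Suc: "q_poch (Suc n) x = (1 - x ^ Suc n) * q_poch n x"
  by (simp add: q_poch_def mult.commute)

lemma q_poch_nonzero:
  fixes x :: "'a::field"
  shows "(\<And>k. 0 < k \<Longrightarrow> x ^ k \<noteq> 1) \<Longrightarrow> q_poch n x \<noteq> 0"
  by (auto simp: q_poch_def)

lemma gauss_binomial_eq_0: "n < k \<Longrightarrow> gauss_binomial n k x = 0"
  by (induction n k x rule: gauss_binomial.induct) auto

text \<open>The product formula without division. The Pascal rule lowers \<open>k\<close> in one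
  term and \<open>n\<close> in the other, hence the induction on \<open>n + k\<close>; the terms
  recombine by \<open>1 - x ^ (n + k) = (1 - x ^ k) + x ^ k * (1 - x ^ n)\<close>.\<close>

lemma gauss_binomial_q_poch:
  "gauss_binomial (n + k) k x * (q_poch k x * q_poch n x) = q_poch (n + k) x"
proof (induction "n + k" arbitrary: n k)
  case (Suc l)
  show ?case
  proof (cases k)
    case k: (Suc k')
    show ?thesis
    proof (cases n)
      case 0
      have "gauss_binomial k' k' x * (q_poch k' x * q_poch 0 x) = q_poch (0 + k') x"
        using Suc.hyps(1)[of 0 k'] Suc.hyps(2) k 0 by simp
      then show ?thesis by (simp add: k 0 q_poch_Suc gauss_binomial_eq_0 algebra_simps)
    next
      case n: (Suc n')
      have 1: "gauss_binomial (n + k') k' x * (q_poch k' x * q_poch n x) = q_poch (n + k') x"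
        using Suc.hyps k by simp
      have 2: "gauss_binomial (n + k') k x * (q_poch k x * q_poch n' x) = q_poch (n + k') x"
        using Suc.hyps(1)[of n' k] Suc.hyps(2) n k by simp
      have "gauss_binomial (n + k) k x * (q_poch k x * q_poch n x) =
          (1 - x ^ k) * (gauss_binomial (n + k') k' x * (q_poch k' x * q_poch n x)) +
          x ^ k * (1 - x ^ n) * (gauss_binomial (n + k') k x * (q_poch k x * q_poch n' x))"
        by (simp add: k n q_poch_Suc algebra_simps del: power_Suc)
      also have "\<dots> = (1 - x ^ (n + k)) * q_poch (n + k') x"
        unfolding 1 2 by (simp add: algebra_simps power_add)
      finally show ?thesis by (simp add: k q_poch_Suc)
    qed
  qed simp
qed simp

text \<open>Extends a weight \<open>f\<close>, indexed by the last letter of a word of length \<open>n\<close>, to words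
  with \<open>k\<close> further letters, each larger than its predecessor.\<close>

fun ascend :: "'a::comm_ring_1 \<Rightarrow> nat \<Rightarrow> (nat \<Rightarrow> 'a) \<Rightarrow> nat \<Rightarrow> nat \<Rightarrow> 'a" where
  "ascend p n f 0 j = f j"
| "ascend p n f (Suc k) j = p ^ (n + Suc k - j) * (\<Sum>i<j. ascend p n f k i)"

text \<open>\<open>ascend\<close> is linear in the initial weight, and \<open>k\<close> steps from
  length \<open>Suc n\<close> after one step from length \<open>n\<close> are \<open>Suc k\<close>
  steps from length \<open>n\<close>.\<close>

lemma ascend_shift:
  assumes "\<And>j. j \<le> Suc n \<Longrightarrow> g j = a * ascend p n f1 1 j + b * ascend p n f2 1 j"
  shows "j \<le> n + Suc k \<Longrightarrow>
    ascend p (Suc n) g k j = a * ascend p n f1 (Suc k) j + b * ascend p n f2 (Suc k) j"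
proof (induction k arbitrary: j)
  case 0
  then show ?case using assms[of j] by simp
next
  case (Suc k)
  have "(\<Sum>i<j. ascend p (Suc n) g k i) =
      (\<Sum>i<j. a * ascend p n f1 (Suc k) i + b * ascend p n f2 (Suc k) i)"
    using Suc.prems by (intro sum.cong refl Suc.IH) auto
  also have "\<dots> = a * (\<Sum>i<j. ascend p n f1 (Suc k) i) + b * (\<Sum>i<j. ascend p n f2 (Suc k) i)"
    by (simp only: sum.distrib sum_distrib_left)
  finally show ?case
    by (simp only: ascend.simps) (simp add: algebra_simps)
qed

text \<open>Weight \<open>1\<close> at the fictitious letter \<open>0\<close> leaves the start of
  the run unconstrained. The run is then any \<open>k\<close>-subset of the letters below
  \<open>j\<close>: each letter from \<open>j\<close> on stands earlier and is inverted with all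
  \<open>k\<close> run letters, and the inversions among letters below \<open>j\<close> give the
  Gaussian binomial.\<close>

lemma sum_ascend_delta:
  "0 < j \<Longrightarrow> j \<le> Suc (n + k) \<Longrightarrow>
    (\<Sum>i<j. ascend p n (\<lambda>i. if i = 0 then 1 else 0) k i) =
    p ^ (k * (Suc (n + k) - j)) * gauss_binomial (j - 1) k p"
proof (induction k arbitrary: j)
  case 0
  then show ?case by (simp add: sum.delta)
next
  case (Suc k)
  note IH = Suc.IH
  show ?case using Suc.prems
  proof (induction j)
    case (Suc j)
    show ?case
    proof (cases "j = 0")
      case False
      define d where "d = Suc (n + k) - j"
      have d: "Suc (n + Suc k) - j = Suc d" "n + Suc k - j = d" "Suc (n + Suc k) - Suc j = d"
        using Suc.prems by (auto simp: d_def)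
      obtain i where i: "j = Suc i" using False by (cases j) auto
      have "(\<Sum>i<j. ascend p n (\<lambda>i. if i = 0 then 1 else 0) (Suc k) i) =
          p ^ (Suc k * Suc d) * gauss_binomial (j - 1) (Suc k) p"
        using Suc.prems False unfolding d(1)[symmetric] by (intro Suc.IH) auto
      moreover have "ascend p n (\<lambda>i. if i = 0 then 1 else 0) (Suc k) j =
          p ^ d * (p ^ (k * d) * gauss_binomial (j - 1) k p)"
        unfolding ascend.simps d using Suc.prems False by (subst IH) (auto simp: d_def)
      \<comment> \<open>The Pascal rule of \<open>gauss_binomial\<close>, multiplied by
        \<open>p ^ (Suc k * d)\<close>.\<close>
      moreover have "p ^ (Suc k * Suc d) * gauss_binomial i (Suc k) p + p ^ d * (p ^ (k * d) * gauss_binomial i k p) =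
          p ^ (Suc k * d) * gauss_binomial (Suc i) (Suc k) p"
        by (simp add: algebra_simps power_add)
      ultimately show ?thesis
        unfolding sum.lessThan_Suc d by (simp only: i diff_Suc_1)
    qed simp
  qed simp
qed

text \<open>The part of \<open>H (n + k) p q\<close> coming from words without a descent at position
  \<open>n\<close> or later.\<close>

definition H_ascend :: "nat \<Rightarrow> nat \<Rightarrow> 'a::comm_ring_1 \<Rightarrow> 'a \<Rightarrow> 'a" where
  "H_ascend n k p q = (\<Sum>j\<le>n + k. ascend p n (H_last n p q) k j)"

lemma H_ascend_0: "H_ascend n 0 p q = H n p q"
  by (simp add: H_ascend_def H_eq_sum_H_last)

text \<open>If the comparison at position \<open>n\<close> is ignored and always charged
  \<open>q ^ n\<close>, the run of \<open>Suc k\<close> letters is free and contributes a Gaussian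
  binomial. Words with an ascent there should have been charged \<open>1\<close>; the correction
  \<open>1 - q ^ n\<close> multiplies exactly their total.\<close>

lemma H_ascend_Suc:
  "H_ascend (Suc n) k p q =
    q ^ n * H n p q * gauss_binomial (n + Suc k) (Suc k) p + (1 - q ^ n) * H_ascend n (Suc k) p q"
proof -
  let ?\<delta> = "\<lambda>i::nat. if i = 0 then 1 else 0 :: 'a"
  have "H_last (Suc n) p q j = q ^ n * H n p q * ascend p n ?\<delta> 1 j + (1 - q ^ n) * ascend p n (H_last n p q) 1 j"
    if "j \<le> Suc n" for j
    using that by (cases "j = 0") (simp_all add: H_last_Suc sum.delta algebra_simps)
  from ascend_shift[OF this]
  have "H_ascend (Suc n) k p q = (\<Sum>j\<le>n + Suc k. q ^ n * H n p q * ascend p n ?\<delta> (Suc k) j +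
      (1 - q ^ n) * ascend p n (H_last n p q) (Suc k) j)"
    unfolding H_ascend_def by (intro sum.cong) auto
  also have "\<dots> = q ^ n * H n p q * (\<Sum>j\<le>n + Suc k. ascend p n ?\<delta> (Suc k) j) + (1 - q ^ n) * H_ascend n (Suc k) p q"
    unfolding H_ascend_def by (simp only: sum.distrib sum_distrib_left)
  also have "(\<Sum>j\<le>n + Suc k. ascend p n ?\<delta> (Suc k) j) = gauss_binomial (n + Suc k) (Suc k) p"
    using sum_ascend_delta[of "Suc (n + Suc k)" n "Suc k" p] by (simp only: lessThan_Suc_atMost) simp
  finally show ?thesis .
qed

section \<open>Exponentials of formal power series\<close>

definition fps_Exp :: "'a::field_char_0 fps \<Rightarrow> 'a fps" where
  "fps_Exp f = fps_exp 1 oo f"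

lemma fps_Exp_nth_0 [simp]: "fps_Exp f $ 0 = 1"
  by (simp add: fps_Exp_def)

lemma fps_Exp_deriv: "f $ 0 = 0 \<Longrightarrow> fps_deriv (fps_Exp f) = fps_Exp f * fps_deriv f"
  by (simp add: fps_Exp_def fps_compose_deriv)

text \<open>The quotient of \<open>g\<close> by \<open>fps_Exp f\<close> has derivative zero, so it
  is constant. Identities between exponentials thereby reduce to checking a differential
  equation.\<close>

lemma fps_Exp_unique:
  fixes f g :: "'a::field_char_0 fps"
  assumes f: "f $ 0 = 0" and g: "g $ 0 = 1" "fps_deriv g = g * fps_deriv f"
  shows "g = fps_Exp f"
proof -
  let ?E = "fps_Exp f"
  have E: "?E $ 0 \<noteq> 0" "?E \<noteq> 0" by (auto simp: fps_eq_iff intro!: exI[of _ 0])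
  then have inv: "inverse ?E * ?E = 1" by (simp add: inverse_mult_eq_1)
  have "fps_deriv (g * inverse ?E) = 0"
    by (simp add: fps_inverse_deriv[OF E(1)] fps_Exp_deriv[OF f] g(2) power2_eq_square)
       (use inv in algebra)
  then have "g * inverse ?E = fps_const ((g * inverse ?E) $ 0)" by (simp only: fps_deriv_eq_0_iff)
  then have "g * inverse ?E = 1" by (simp add: g(1))
  then show ?thesis using inv by algebra
qed

lemma fps_Exp_add:
  assumes "f $ 0 = 0" "g $ 0 = 0"
  shows "fps_Exp (f + g) = fps_Exp f * fps_Exp g"
  by (rule fps_Exp_unique[symmetric]) (use assms in \<open>simp_all add: fps_Exp_deriv algebra_simps\<close>)

lemma fps_Exp_compose:
  "f $ 0 = 0 \<Longrightarrow> g $ 0 = 0 \<Longrightarrow> fps_Exp f oo g = fps_Exp (f oo g)"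
  by (simp add: fps_Exp_def fps_compose_assoc)

text \<open>The argument is \<open>-log (1 - z)\<close>, with constant term
  \<open>1 / 0 = 0\<close>, and the result is \<open>1 / (1 - z)\<close>.\<close>

lemma fps_Exp_log_series: "fps_Exp (Abs_fps (\<lambda>k. 1 / of_nat k)) = Abs_fps (\<lambda>_. 1)"
proof (rule fps_Exp_unique[symmetric])
  let ?G = "Abs_fps (\<lambda>_. 1) :: 'a fps"
  have "fps_deriv (Abs_fps (\<lambda>k. 1 / of_nat k)) = ?G"
    by (simp add: fps_eq_iff del: of_nat_Suc)
  moreover have "fps_deriv ?G = ?G * ?G"
    by (simp add: fps_eq_iff fps_mult_nth)
  ultimately show "fps_deriv ?G = ?G * fps_deriv (Abs_fps (\<lambda>k. 1 / of_nat k))" by simp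
qed simp_all

text \<open>The generating function of the complete homogeneous symmetric functions in terms of the
  power sums \<open>x k\<close>; the summand at \<open>k = 0\<close> vanishes because \<open>x 0 / 0 = 0\<close>.\<close>

definition h_series :: "(nat \<Rightarrow> 'a::field_char_0) \<Rightarrow> 'a fps" where
  "h_series x = fps_Exp (Abs_fps (\<lambda>k. x k / of_nat k))"

lemma h_series_nth_0 [simp]: "h_series x $ 0 = 1"
  by (simp add: h_series_def)

lemma h_series_add: "h_series (\<lambda>k. x k + y k) = h_series x * h_series y"
  unfolding h_series_def
  by (subst fps_Exp_add[symmetric], simp, simp, rule arg_cong[where f = fps_Exp])
     (simp add: fps_eq_iff add_divide_distrib)

lemma h_series_cong: "(\<And>k. 0 < k \<Longrightarrow> x k = y k) \<Longrightarrow> h_series x = h_series y"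
  unfolding h_series_def by (intro arg_cong[where f = fps_Exp]) (auto simp: fps_eq_iff)

text \<open>The substitution of \<open>c * z\<close> for \<open>z\<close>, which commutes with the
  exponential.\<close>

lemma h_series_scale: "h_series (\<lambda>k. c ^ k * x k) = Abs_fps (\<lambda>n. c ^ n * h_series x $ n)"
proof -
  let ?f = "Abs_fps (\<lambda>k. x k / of_nat k)"
  have "Abs_fps (\<lambda>n. c ^ n * h_series x $ n) = fps_Exp ?f oo (fps_const c * fps_X)"
    unfolding h_series_def by (rule fps_compose_linear[symmetric])
  also have "\<dots> = fps_Exp (?f oo (fps_const c * fps_X))"
    by (rule fps_Exp_compose) simp_all
  also have "?f oo (fps_const c * fps_X) = Abs_fps (\<lambda>k. c ^ k * x k / of_nat k)"
    unfolding fps_compose_linear by simp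
  finally show ?thesis by (simp add: h_series_def)
qed

text \<open>The coefficient of \<open>z ^ n\<close> in the differential equation of the exponential;
  differentiation cancels the denominators \<open>k\<close>.\<close>

lemma h_series_newton:
  "of_nat (Suc n) * h_series x $ Suc n = (\<Sum>i\<le>n. h_series x $ i * x (Suc (n - i)))"
proof -
  let ?f = "Abs_fps (\<lambda>k. x k / of_nat k)"
  have "fps_deriv (h_series x) = h_series x * fps_deriv ?f"
    unfolding h_series_def by (rule fps_Exp_deriv) simp
  then have "fps_deriv (h_series x) $ n = (h_series x * fps_deriv ?f) $ n" by simp
  moreover have "fps_deriv ?f = Abs_fps (\<lambda>k. x (Suc k))"
    by (simp add: fps_eq_iff del: of_nat_Suc)
  ultimately show ?thesis
    by (simp add: fps_mult_nth atLeast0AtMost del: of_nat_Suc)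
qed

text \<open>Euler's expansion. From \<open>1 / (1 - p ^ k) = p ^ k / (1 - p ^ k) + 1\<close> follows
  \<open>C(z) = C(p z) / (1 - z)\<close>, so each coefficient is a partial sum of the
  \<open>p ^ i * ?C $ i\<close>; subtracting consecutive ones gives a first-order
  recurrence.\<close>

lemma h_series_geometric:
  fixes p :: "'a::field_char_0"
  assumes p: "\<And>k. 0 < k \<Longrightarrow> p ^ k \<noteq> 1"
  shows "h_series (\<lambda>k. 1 / (1 - p ^ k)) $ n = 1 / q_poch n p"
proof (induction n)
  case (Suc n)
  let ?C = "h_series (\<lambda>k. 1 / (1 - p ^ k))"
  have "?C = h_series (\<lambda>k. p ^ k * (1 / (1 - p ^ k)) + 1)"
    using p by (intro h_series_cong) (simp add: field_simps)
  also have "\<dots> = Abs_fps (\<lambda>n. p ^ n * ?C $ n) * Abs_fps (\<lambda>_. 1)"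
    by (simp only: h_series_add h_series_scale) (simp add: h_series_def fps_Exp_log_series)
  finally have "?C $ m = (Abs_fps (\<lambda>n. p ^ n * ?C $ n) * Abs_fps (\<lambda>_. 1)) $ m" for m
    by (rule arg_cong)
  then have C: "?C $ m = (\<Sum>i\<le>m. p ^ i * ?C $ i)" for m
    unfolding fps_mult_nth atLeast0AtMost fps_nth_Abs_fps mult_1_right .
  have "?C $ Suc n = ?C $ n + p ^ Suc n * ?C $ Suc n"
    using C[of "Suc n"] unfolding sum.atMost_Suc C[of n, symmetric] .
  then have "(1 - p ^ Suc n) * ?C $ Suc n = 1 / q_poch n p"
    using Suc.IH by (simp add: algebra_simps)
  moreover have "1 - p ^ Suc n \<noteq> 0" using p[of "Suc n"] by simp
  ultimately have "?C $ Suc n = (1 / q_poch n p) / (1 - p ^ Suc n)"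
    by (metis nonzero_mult_div_cancel_left)
  then show ?case by (simp add: q_poch_Suc mult.commute)
qed simp

text \<open>Coefficients of \<open>A(z) = A(q z) C(z)\<close>, with the term
  \<open>i = Suc n\<close> of the convolution moved to the left.\<close>

lemma h_series_double_geometric:
  fixes p q :: "'a::field_char_0"
  assumes p: "\<And>k. 0 < k \<Longrightarrow> p ^ k \<noteq> 1" and q: "\<And>k. 0 < k \<Longrightarrow> q ^ k \<noteq> 1"
  defines "A \<equiv> h_series (\<lambda>k. 1 / ((1 - p ^ k) * (1 - q ^ k)))"
  shows "(1 - q ^ Suc n) * A $ Suc n = (\<Sum>i\<le>n. q ^ i * A $ i / q_poch (Suc n - i) p)"
proof -
  have C: "h_series (\<lambda>k. 1 / (1 - p ^ k)) $ m = 1 / q_poch m p" for m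
    using p by (rule h_series_geometric)
  have "A = h_series (\<lambda>k. q ^ k * (1 / ((1 - p ^ k) * (1 - q ^ k))) + 1 / (1 - p ^ k))"
    unfolding A_def
  proof (rule h_series_cong)
    fix k :: nat assume "0 < k"
    define a b where "a = 1 - p ^ k" and "b = 1 - q ^ k"
    have "a \<noteq> 0" "b \<noteq> 0" using p q \<open>0 < k\<close> by (auto simp: a_def b_def)
    moreover have "q ^ k = 1 - b" by (simp add: b_def)
    ultimately show "1 / ((1 - p ^ k) * (1 - q ^ k)) = q ^ k * (1 / ((1 - p ^ k) * (1 - q ^ k))) + 1 / (1 - p ^ k)"
      unfolding a_def[symmetric] b_def[symmetric] by (simp add: field_simps)
  qed
  also have "\<dots> = Abs_fps (\<lambda>n. q ^ n * A $ n) * h_series (\<lambda>k. 1 / (1 - p ^ k))"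
    by (simp only: h_series_add h_series_scale A_def)
  finally have "A $ Suc n = (Abs_fps (\<lambda>n. q ^ n * A $ n) * h_series (\<lambda>k. 1 / (1 - p ^ k))) $ Suc n"
    by (rule arg_cong)
  then have "A $ Suc n = (\<Sum>i\<le>Suc n. q ^ i * A $ i * (1 / q_poch (Suc n - i) p))"
    unfolding fps_mult_nth atLeast0AtMost fps_nth_Abs_fps C .
  then show ?thesis by (simp add: algebra_simps)
qed

text \<open>Only the integrality of the coefficients matters; they are in fact the numbers \<open>n! / z\<^sub>\<mu>\<close>
  of permutations of cycle type \<open>\<mu>\<close>.\<close>

lemma fact_h_series_expansion:
  fixes x :: "nat \<Rightarrow> 'a::field_char_0"
  shows "\<exists>c :: nat list \<Rightarrow> int. fact n * h_series x $ n =
    (\<Sum>\<mu>\<in>partitions n. of_int (c \<mu>) * (\<Prod>m\<leftarrow>\<mu>. x m))"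
proof -
  \<comment> \<open>\<open>L n\<close> is the additive group of integral combinations in degree
    \<open>n\<close>. It suffices that multiplication by \<open>x k\<close> maps \<open>L n\<close>
    into \<open>L (k + n)\<close>, since the Newton recurrence then stays inside these
    groups.\<close>
  define L :: "nat \<Rightarrow> 'a set" where "L = (\<lambda>n. range (\<lambda>c :: nat list \<Rightarrow> int. \<Sum>\<mu>\<in>partitions n. of_int (c \<mu>) * (\<Prod>m\<leftarrow>\<mu>. x m)))"
  have zero: "0 \<in> L n" for n
    unfolding L_def by (rule range_eqI[of _ _ "\<lambda>_. 0"]) simp
  have add: "a + b \<in> L n" if ab: "a \<in> L n" "b \<in> L n" for a b n
  proof -
    obtain c d where "a = (\<Sum>\<mu>\<in>partitions n. of_int (c \<mu>) * (\<Prod>m\<leftarrow>\<mu>. x m))"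
      "b = (\<Sum>\<mu>\<in>partitions n. of_int (d \<mu>) * (\<Prod>m\<leftarrow>\<mu>. x m))"
      using ab unfolding L_def by blast
    then show ?thesis
      unfolding L_def by (intro range_eqI[of _ _ "\<lambda>\<mu>. c \<mu> + d \<mu>"]) (simp add: sum.distrib algebra_simps)
  qed
  have scale: "of_int z * a \<in> L n" if a: "a \<in> L n" for z a n
  proof -
    obtain c where "a = (\<Sum>\<mu>\<in>partitions n. of_int (c \<mu>) * (\<Prod>m\<leftarrow>\<mu>. x m))"
      using a unfolding L_def by blast
    then show ?thesis
      unfolding L_def by (intro range_eqI[of _ _ "\<lambda>\<mu>. z * c \<mu>"]) (simp add: sum_distrib_left algebra_simps)
  qed
  have sum: "sum f I \<in> L n" if "\<And>i. i \<in> I \<Longrightarrow> f i \<in> L n" for f :: "'b \<Rightarrow> 'a" and I n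
    using that by (induction I rule: infinite_finite_induct) (auto intro: zero add)
  have single: "(\<Prod>m\<leftarrow>\<mu>. x m) \<in> L n" if "\<mu> \<in> partitions n" for \<mu> n
    unfolding L_def
    by (rule range_eqI[of _ _ "\<lambda>\<nu>. if \<nu> = \<mu> then 1 else 0"])
       (simp add: that finite_partitions if_distrib[of of_int] if_distrib[of "\<lambda>z. z * _"] cong: if_cong)
  have mult: "x k * a \<in> L (k + n)" if a: "a \<in> L n" and k: "0 < k" for a k n
  proof -
    obtain c where c: "a = (\<Sum>\<mu>\<in>partitions n. of_int (c \<mu>) * (\<Prod>m\<leftarrow>\<mu>. x m))"
      using a unfolding L_def by blast
    have "x k * (\<Prod>m\<leftarrow>\<mu>. x m) \<in> L (k + n)" if \<mu>: "\<mu> \<in> partitions n" for \<mu>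
    proof -
      \<comment> \<open>The part \<open>k\<close> is added to the partition; sorting restores the
        decreasing list.\<close>
      define \<nu> where "\<nu> = rev (sort (k # \<mu>))"
      have ms: "mset \<nu> = add_mset k (mset \<mu>)" by (simp add: \<nu>_def)
      have "set \<nu> = insert k (set \<mu>)" using ms by (metis set_mset_mset set_mset_add_mset_insert)
      moreover have "sum_list \<nu> = k + sum_list \<mu>"
        by (simp flip: sum_mset_sum_list add: ms)
      moreover have "sorted_wrt (\<ge>) \<nu>" by (simp add: \<nu>_def sorted_wrt_rev del: sort_key_simps sort_key_def)
      ultimately have "\<nu> \<in> partitions (k + n)" using \<mu> k by (auto simp: partitions_def)
      moreover have "(\<Prod>m\<leftarrow>\<nu>. x m) = x k * (\<Prod>m\<leftarrow>\<mu>. x m)"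
        by (simp flip: prod_mset_prod_list add: ms)
      ultimately show ?thesis using single by metis
    qed
    then have "(\<Sum>\<mu>\<in>partitions n. of_int (c \<mu>) * (x k * (\<Prod>m\<leftarrow>\<mu>. x m))) \<in> L (k + n)"
      by (intro sum scale)
    then show ?thesis by (simp add: c sum_distrib_left mult.left_commute)
  qed
  have "fact n * h_series x $ n \<in> L n"
  proof (induction n rule: less_induct)
    case (less n)
    show ?case
    proof (cases n)
      case 0
      have "[] \<in> partitions 0" by (simp add: partitions_def)
      from single[OF this] show ?thesis by (simp add: 0)
    next
      case (Suc m)
      have "fact n * h_series x $ n = fact m * (of_nat (Suc m) * h_series x $ Suc m)"
        by (simp add: Suc algebra_simps)
      \<comment> \<open>The induction hypothesis concerns \<open>fact i * h_series x $ i\<close>;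
        the remaining quotient of factorials is an integer because \<open>i \<le> m\<close>.\<close>
      also have "\<dots> = (\<Sum>i\<le>m. of_int (fact m div fact i) * (x (Suc (m - i)) * (fact i * h_series x $ i)))"
        unfolding h_series_newton sum_distrib_left
      proof (intro sum.cong refl)
        fix i assume "i \<in> {..m}"
        then have "(fact m :: int) = (fact m div fact i) * fact i" by (simp add: fact_dvd)
        then have "(fact m :: 'a) = of_int (fact m div fact i) * fact i"
          by (metis of_int_fact of_int_mult)
        then show "fact m * (h_series x $ i * x (Suc (m - i))) =
            of_int (fact m div fact i) * (x (Suc (m - i)) * (fact i * h_series x $ i))"
          by (simp add: algebra_simps)
      qed
      also have "\<dots> \<in> L n"
      proof (intro sum scale)
        fix i assume "i \<in> {..m}"
        then have "x (Suc (m - i)) * (fact i * h_series x $ i) \<in> L (Suc (m - i) + i)"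
          by (intro mult less) (auto simp: Suc)
        then show "x (Suc (m - i)) * (fact i * h_series x $ i) \<in> L n"
          using \<open>i \<in> {..m}\<close> by (simp add: Suc)
      qed
      finally show ?thesis .
    qed
  qed
  then show ?thesis unfolding L_def by blast
qed

section \<open>The expansion over partitions\<close>

text \<open>\<open>H_ascend_Suc\<close> is iterated with the total length fixed, until the factor
  \<open>1 - q ^ 0 = 0\<close> ends the recursion. The factors \<open>1 - q ^ i\<close> build up
  \<open>q_poch n q\<close>, and the Gaussian binomials become quotients of
  \<open>q_poch\<close>.\<close>

lemma H_ascend_expansion:
  fixes p q :: "'a::field_char_0" and a :: "nat \<Rightarrow> 'a"
  assumes p: "\<And>k. 0 < k \<Longrightarrow> p ^ k \<noteq> 1"
    and H: "\<And>i. i \<le> n \<Longrightarrow> H i p q = q_poch i p * q_poch i q * a i"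
  shows "H_ascend (Suc n) k p q =
    q_poch (Suc n + k) p * q_poch n q * (\<Sum>i\<le>n. q ^ i * a i / q_poch (Suc n + k - i) p)"
  using H
proof (induction n arbitrary: k)
  case (0 k)
  have "q_poch (Suc k) p \<noteq> 0" using p by (rule q_poch_nonzero)
  moreover from this have "gauss_binomial (Suc k) (Suc k) p = 1"
    using gauss_binomial_q_poch[of 0 "Suc k" p] by simp
  ultimately show ?case using 0[of 0] by (simp add: H_ascend_Suc del: gauss_binomial.simps)
next
  case (Suc n k)
  let ?N = "Suc n + Suc k"
  have "q_poch (Suc k) p \<noteq> 0" using p by (rule q_poch_nonzero)
  then have "gauss_binomial ?N (Suc k) p * q_poch (Suc n) p = q_poch ?N p / q_poch (Suc k) p"
    using gauss_binomial_q_poch[of "Suc n" "Suc k" p] by (simp add: eq_divide_eq ac_simps)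
  moreover have "q ^ Suc n * H (Suc n) p q * gauss_binomial ?N (Suc k) p =
      q_poch (Suc n) q * (q ^ Suc n * a (Suc n)) * (gauss_binomial ?N (Suc k) p * q_poch (Suc n) p)"
    by (simp only: Suc.prems[OF order_refl] ac_simps)
  ultimately have "q ^ Suc n * H (Suc n) p q * gauss_binomial ?N (Suc k) p =
      q_poch ?N p * q_poch (Suc n) q * (q ^ Suc n * a (Suc n) / q_poch (Suc k) p)"
    by (simp only: times_divide_eq_right ac_simps)
  moreover have "(1 - q ^ Suc n) * H_ascend (Suc n) (Suc k) p q =
      q_poch ?N p * q_poch (Suc n) q * (\<Sum>i\<le>n. q ^ i * a i / q_poch (?N - i) p)"
  proof -
    have "H_ascend (Suc n) (Suc k) p q =
        q_poch ?N p * q_poch n q * (\<Sum>i\<le>n. q ^ i * a i / q_poch (?N - i) p)"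
      using Suc.prems by (intro Suc.IH) simp
    then show ?thesis by (simp only: q_poch_Suc mult.assoc mult.left_commute)
  qed
  ultimately show ?case
    by (simp add: H_ascend_Suc[of "Suc n"] distrib_left del: power_Suc gauss_binomial.simps)
qed

text \<open>Both sides obey the same recurrence: the sum from \<open>H_ascend_expansion\<close> at
  \<open>k = 0\<close> is evaluated by \<open>h_series_double_geometric\<close>, and its factor
  \<open>1 - q ^ Suc m\<close> completes \<open>q_poch m q\<close>.\<close>

lemma H_eq_h_series:
  fixes p q :: "'a::field_char_0"
  assumes p: "\<And>k. 0 < k \<Longrightarrow> p ^ k \<noteq> 1" and q: "\<And>k. 0 < k \<Longrightarrow> q ^ k \<noteq> 1"
  shows "H n p q = q_poch n p * q_poch n q * h_series (\<lambda>k. 1 / ((1 - p ^ k) * (1 - q ^ k))) $ n"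
proof (induction n rule: less_induct)
  case (less n)
  let ?A = "h_series (\<lambda>k. 1 / ((1 - p ^ k) * (1 - q ^ k)))"
  show ?case
  proof (cases n)
    case 0
    then show ?thesis by (simp add: H_eq_sum_H_last H_last_0)
  next
    case (Suc m)
    have "H_ascend (Suc m) 0 p q =
        q_poch (Suc m + 0) p * q_poch m q * (\<Sum>i\<le>m. q ^ i * ?A $ i / q_poch (Suc m + 0 - i) p)"
      using p less by (intro H_ascend_expansion) (auto simp: Suc)
    also have "(\<Sum>i\<le>m. q ^ i * ?A $ i / q_poch (Suc m + 0 - i) p) = (1 - q ^ Suc m) * ?A $ Suc m"
      using h_series_double_geometric[of p q m] p q by simp
    finally show ?thesis by (simp only: Suc H_ascend_0 q_poch_Suc[of m q] add_0_right mult.assoc mult.left_commute)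
  qed
qed

section \<open>From q-Pochhammer symbols to q-integers and q-factorials\<close>

lemma one_diff_power_eq_q_int: "1 - x ^ n = (1 - x) * q_int n x"
  by (simp add: q_int_def one_diff_power_eq)

lemma q_poch_eq_q_fact: "q_poch n x = (1 - x) ^ n * q_fact n x"
  by (simp add: q_poch_def q_fact_def one_diff_power_eq_q_int prod.distrib)

lemma length_partition_le: "\<mu> \<in> partitions n \<Longrightarrow> length \<mu> \<le> n"
proof -
  have "length \<mu> \<le> sum_list \<mu>" if "\<forall>m\<in>set \<mu>. m > 0" for \<mu> :: "nat list"
    using that by (induction \<mu>) auto
  then show "\<mu> \<in> partitions n \<Longrightarrow> length \<mu> \<le> n" by (auto simp: partitions_def)
qed

text \<open>Each part of \<open>\<mu>\<close> releases one factor \<open>(1 - p) * (1 - q)\<close>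
  on passing to q-integers, so the exponent left from \<open>n\<close> is
  \<open>n - length \<mu>\<close>, which is the index \<open>d\<close> in \<open>F\<close>.\<close>

lemma F_eq_sum_partitions:
  fixes p q :: "'a::field"
  assumes "p \<noteq> 1" "q \<noteq> 1"
  shows "F c n p q = ((1 - p) * (1 - q)) ^ n *
    (\<Sum>\<mu>\<in>partitions n. of_int (c \<mu>) * (\<Prod>m\<leftarrow>\<mu>. 1 / ((1 - p ^ m) * (1 - q ^ m))))"
proof -
  let ?u = "(1 - p) * (1 - q)"
  let ?Q = "\<lambda>\<mu>. \<Prod>i<length \<mu>. q_int (\<mu> ! i) p * q_int (\<mu> ! i) q"
  have u: "?u \<noteq> 0" using assms by simp
  have prod: "(\<Prod>m\<leftarrow>\<mu>. 1 / ((1 - p ^ m) * (1 - q ^ m))) = 1 / (?u ^ length \<mu> * ?Q \<mu>)" for \<mu>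
    by (simp add: prod.list_conv_set_nth atLeast0LessThan one_diff_power_eq_q_int
        prod.distrib prod_dividef power_mult_distrib ac_simps)
  have summand: "?u ^ n * (of_int (c \<mu>) * (\<Prod>m\<leftarrow>\<mu>. 1 / ((1 - p ^ m) * (1 - q ^ m)))) =
      ?u ^ (n - length \<mu>) * (of_int (c \<mu>) / ?Q \<mu>)" if "\<mu> \<in> partitions n" for \<mu>
  proof -
    have pow: "?u ^ n = ?u ^ (n - length \<mu>) * ?u ^ length \<mu>"
      using length_partition_le[OF that] by (simp flip: power_add)
    \<comment> \<open>For \<open>s = 0\<close> both sides are \<open>0\<close> by the convention for
      division.\<close>
    have cancel: "a * b * (r * (1 / (b * s))) = a * (r / s)" if "b \<noteq> 0" for a b r s :: 'a
      using that by simp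
    show ?thesis unfolding prod pow using u by (intro cancel power_not_zero)
  qed
  have "F c n p q = (\<Sum>d=0..n. \<Sum>\<mu> | \<mu> \<in> partitions n \<and> n - length \<mu> = d.
      ?u ^ (n - length \<mu>) * (of_int (c \<mu>) / ?Q \<mu>))"
    unfolding F_def sum_distrib_left
  proof (rule sum.cong[OF refl], rule sum.cong)
    fix d assume d: "d \<in> {0..n}"
    \<comment> \<open>With truncated subtraction this relies on both \<open>d\<close> and the length
      being at most \<open>n\<close>.\<close>
    have "length \<mu> = n - d \<longleftrightarrow> n - length \<mu> = d" if "\<mu> \<in> partitions n" for \<mu>
      using d length_partition_le[OF that] by auto
    then show "{\<mu>. \<mu> \<in> partitions n \<and> length \<mu> = n - d} = {\<mu>. \<mu> \<in> partitions n \<and> n - length \<mu> = d}"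
      by blast
  next
    fix d \<mu> assume "\<mu> \<in> {\<mu>. \<mu> \<in> partitions n \<and> n - length \<mu> = d}"
    then have "n - length \<mu> = d" by blast
    then show "?u ^ d * (of_int (c \<mu>) / ?Q \<mu>) = ?u ^ (n - length \<mu>) * (of_int (c \<mu>) / ?Q \<mu>)"
      by (simp only:)
  qed
  also have "\<dots> = (\<Sum>\<mu>\<in>partitions n. ?u ^ (n - length \<mu>) * (of_int (c \<mu>) / ?Q \<mu>))"
    by (rule sum.group) (auto simp: finite_partitions)
  also have "\<dots> = (\<Sum>\<mu>\<in>partitions n. ?u ^ n * (of_int (c \<mu>) * (\<Prod>m\<leftarrow>\<mu>. 1 / ((1 - p ^ m) * (1 - q ^ m)))))"
    by (intro sum.cong refl summand[symmetric])
  finally show ?thesis by (simp only: sum_distrib_left)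
qed

lemma fact_H_eq_F:
  fixes p q :: "'a::field_char_0"
  assumes p: "\<And>k. 0 < k \<Longrightarrow> p ^ k \<noteq> 1" and q: "\<And>k. 0 < k \<Longrightarrow> q ^ k \<noteq> 1"
  shows "\<exists>c. \<forall>n. fact n * H n p q = q_fact n p * q_fact n q * F c n p q"
proof -
  let ?x = "\<lambda>k. 1 / ((1 - p ^ k) * (1 - q ^ k))"
  have "\<forall>n. \<exists>c :: nat list \<Rightarrow> int. fact n * h_series ?x $ n =
      (\<Sum>\<mu>\<in>partitions n. of_int (c \<mu>) * (\<Prod>m\<leftarrow>\<mu>. ?x m))"
    by (intro allI fact_h_series_expansion)
  from choice[OF this] obtain c :: "nat \<Rightarrow> nat list \<Rightarrow> int" where
    c: "fact n * h_series ?x $ n = (\<Sum>\<mu>\<in>partitions n. of_int (c n \<mu>) * (\<Prod>m\<leftarrow>\<mu>. ?x m))" for n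
    by blast
  \<comment> \<open>The coefficients were chosen separately for each \<open>n\<close>; since
    \<open>\<mu>\<close> determines \<open>n\<close> as its sum, they combine into one function of
    \<open>\<mu>\<close>.\<close>
  have "fact n * H n p q = q_fact n p * q_fact n q * F (\<lambda>\<mu>. c (sum_list \<mu>) \<mu>) n p q" for n
  proof -
    have "(\<Sum>\<mu>\<in>partitions n. of_int (c (sum_list \<mu>) \<mu>) * (\<Prod>m\<leftarrow>\<mu>. ?x m)) = fact n * h_series ?x $ n"
      unfolding c by (intro sum.cong refl) (simp add: partitions_def)
    moreover have "p \<noteq> 1" "q \<noteq> 1" using p[of 1] q[of 1] by auto
    note F_eq_sum_partitions[OF this, of "\<lambda>\<mu>. c (sum_list \<mu>) \<mu>" n]
    ultimately have "F (\<lambda>\<mu>. c (sum_list \<mu>) \<mu>) n p q = ((1 - p) * (1 - q)) ^ n * (fact n * h_series ?x $ n)"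
      by (simp only:)
    moreover have "H n p q = q_poch n p * q_poch n q * h_series ?x $ n"
      using p q by (rule H_eq_h_series)
    ultimately show ?thesis
      by (simp only: q_poch_eq_q_fact power_mult_distrib ac_simps)
  qed
  then show ?thesis by blast
qed

section \<open>The indeterminates of the rational function field\<close>

lemma Fract_1_power: "Fraction_Field.Fract a 1 ^ k = Fraction_Field.Fract (a ^ k) 1"
  by (induction k) (simp_all add: One_fract_def)

lemma indet_p_power_neq_1: "0 < k \<Longrightarrow> indet_p ^ k \<noteq> 1"
proof
  assume k: "0 < k" and "indet_p ^ k = 1"
  then have "[:[:0, 1:]:] ^ k = (1 :: rat poly poly)"
    by (simp add: indet_p_def Fract_1_power One_fract_def eq_fract)
  \<comment> \<open>The variable \<open>p\<close> is a constant of the outer polynomial ring, so a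
    second evaluation is needed to send it to \<open>0\<close>.\<close>
  then have "poly (poly ([:[:0, 1:]:] ^ k) 0) 0 = (1 :: rat)" by simp
  then show False using k by (simp add: power_0_left)
qed

lemma indet_q_power_neq_1: "0 < k \<Longrightarrow> indet_q ^ k \<noteq> 1"
proof
  assume k: "0 < k" and "indet_q ^ k = 1"
  then have "[:0, 1:] ^ k = (1 :: rat poly poly)"
    by (simp add: indet_q_def Fract_1_power One_fract_def eq_fract)
  then have "poly ([:0, 1:] ^ k) 0 = (1 :: rat poly)" by simp
  then show False using k by (simp add: power_0_left)
qed

theorem theorem2p3:
  shows "\<exists>c :: nat list \<Rightarrow> int. \<forall>n :: nat.
    H n indet_p indet_q / of_nat (fact n) =
      q_fact n indet_p * q_fact n indet_q / (of_nat (fact n))\<^sup>2 * F c n indet_p indet_q"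
proof -
  obtain c where c: "fact n * H n indet_p indet_q =
      q_fact n indet_p * q_fact n indet_q * F c n indet_p indet_q" for n
    using fact_H_eq_F[OF indet_p_power_neq_1 indet_q_power_neq_1] by blast
  have "H n indet_p indet_q / of_nat (fact n) =
      q_fact n indet_p * q_fact n indet_q / (of_nat (fact n))\<^sup>2 * F c n indet_p indet_q" for n
  proof -
    have "H n indet_p indet_q / of_nat (fact n) = (fact n * H n indet_p indet_q) / (of_nat (fact n))\<^sup>2"
      by (simp add: power2_eq_square)
    then show ?thesis by (simp add: c)
  qed
  then show ?thesis by blast
qed

end
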